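(* Let $n\ge 1$ be an integer, $r,s>1$, $\alpha\in(0,n)$, and suppose $\frac1r+\frac1s+\frac{n-\alpha}{n}>2$. Then there is a constant $c_{r,s,\alpha}>0$, independent of $N$ (it may depend on $n,r,s,\alpha$), such that for every integer $N\ge1$ and every nonnegative normalized maximizing pair $(f^N,g^N)$ of the discrete Hardy-Littlewood-Sobolev inequality restricted to $\{i\in\mathbb Z^n:|i|\le N\}$, $$\max_{|i|\le N} f_i^N\ge c_{r,s,\alpha}\quad\text{and}\quad \max_{|i|\le N} g_i^N\ge c_{r,s,\alpha}.$$
   Context: $|i|$ is the Euclidean norm on $\mathbb Z^n$, and $|f|_{l^r}=\left(\sum_{i\in\mathbb Z^n}|f_i|^r\right)^{1/r}$. For real sequences $f,g$ indexed by $\mathbb Z^n$ put $$J(f,g)=\sum_{i\in\mathbb Z^n}\ \sum_{j\in\mathbb Z^n,\ j\ne i}\frac{f_i g_j}{|i-j|^{n-\alpha}}.$$ For an integer $N\ge 1$, $C_{r,s,\alpha,N}$ is the smallest constant $C$ such that $J(f,g)\le C|f|_{l^r}|g|_{l^s}$ for all $f,g$ with $f_i=g_i=0$ whenever $|i|>N$. A nonnegative normalized maximizing pair $(f^N,g^N)$ is a pair of sequences with $f^N_i,g^N_i\ge 0$ for all $i$, $f^N_i=g^N_i=0$ for $|i|>N$, $|f^N|_{l^r}=|g^N|_{l^s}=1$ and $J(f^N,g^N)=C_{r,s,\alpha,N}$. *)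

theory Defs
  imports "HOL-Analysis.Analysis"
begin

text \<open>The lattice of integer points in n-space is \<^typ>\<open>int ^ 'n\<close>, with \<open>n = CARD('n)\<close>.\<close>

definition lattice_norm :: "int ^ 'n \<Rightarrow> real" where
  "lattice_norm i = norm ((\<chi> k. real_of_int (i $ k)) :: real ^ 'n)"

text \<open>
  An infinite sum that does not converge has the value 0 in the library, so \<open>l_norm\<close> and
  \<open>HLS_form\<close> are meaningful only when the sums converge. Below they are applied only to
  sequences supported in a ball, where every sum has finitely many nonzero terms.
\<close>

definition l_norm :: "real \<Rightarrow> (int ^ 'n \<Rightarrow> real) \<Rightarrow> real" where
  "l_norm r f = (\<Sum>\<^sub>\<infinity>i\<in>UNIV. \<bar>f i\<bar> powr r) powr (1 / r)"

definition HLS_form :: "real \<Rightarrow> (int ^ 'n \<Rightarrow> real) \<Rightarrow> (int ^ 'n \<Rightarrow> real) \<Rightarrow> real" where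
  "HLS_form \<alpha> f g =
     (\<Sum>\<^sub>\<infinity>i\<in>UNIV. \<Sum>\<^sub>\<infinity>j\<in>{j. j \<noteq> i}.
        f i * g j / lattice_norm (i - j) powr (real CARD('n) - \<alpha>))"

definition supported_in_ball :: "nat \<Rightarrow> (int ^ 'n \<Rightarrow> real) \<Rightarrow> bool" where
  "supported_in_ball N f \<longleftrightarrow> (\<forall>i. lattice_norm i > real N \<longrightarrow> f i = 0)"

text \<open>The dimension enters the constant only through the index type, hence the type argument.\<close>

definition HLS_const :: "'n::finite itself \<Rightarrow> real \<Rightarrow> real \<Rightarrow> real \<Rightarrow> nat \<Rightarrow> real" where
  "HLS_const _ r s \<alpha> N =
     (LEAST C. \<forall>f g :: int ^ 'n \<Rightarrow> real.
        supported_in_ball N f \<longrightarrow> supported_in_ball N g \<longrightarrow>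
        HLS_form \<alpha> f g \<le> C * l_norm r f * l_norm s g)"

definition maximizing_pair ::
  "real \<Rightarrow> real \<Rightarrow> real \<Rightarrow> nat \<Rightarrow> (int ^ 'n \<Rightarrow> real) \<Rightarrow> (int ^ 'n \<Rightarrow> real) \<Rightarrow> bool" where
  "maximizing_pair r s \<alpha> N f g \<longleftrightarrow>
     (\<forall>i. 0 \<le> f i) \<and> (\<forall>i. 0 \<le> g i) \<and>
     supported_in_ball N f \<and> supported_in_ball N g \<and>
     l_norm r f = 1 \<and> l_norm s g = 1 \<and>
     HLS_form \<alpha> f g = HLS_const TYPE('n) r s \<alpha> N"

end

theory Submission
  imports Defs
begin

text \<open>
  Testing with two neighbouring unit masses shows that the optimal constant is at least 1 for
  every \<open>N \<ge> 1\<close>. The strict inequality on the exponents leaves room to choose \<open>a < 1 / r\<close> such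
  that \<open>c = 2 - a - 1 / s\<close> still satisfies \<open>0 < c < (n - \<alpha>) / n\<close>; then the power \<open>1 / c\<close> of the
  kernel is summable over the lattice. If \<open>f \<le> M\<close>, then \<open>f \<le> M powr (1 - r * a) * (f powr r) powr a\<close>,
  and Young's convolution inequality bounds \<open>J(f, g)\<close> by a constant times \<open>M powr (1 - r * a)\<close>.
  Since \<open>J(f, g) \<ge> 1\<close> for a maximizing pair, \<open>M\<close> is bounded below. The bound for \<open>g\<close> follows
  by symmetry.
\<close>

section \<open>Summability of powers of the lattice norm\<close>

text \<open>Absolute value and sign determine an integer, so the sum is at most twice the convergent
  series of \<open>real (Suc k) powr (- q)\<close>.\<close>

lemma sum_int_powr_bounded:
  fixes q :: real
  assumes "q > 1"
  obtains K where "\<And>F. finite F \<Longrightarrow> (\<Sum>m\<in>F. (1 + \<bar>real_of_int m\<bar>) powr (- q)) \<le> K"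
proof -
  let ?w = "\<lambda>k::nat. real (Suc k) powr (- q)"
  have "summable (\<lambda>k. real k powr (- q))"
    using assms summable_real_powr_iff[of "- q"] by simp
  then have sm: "summable ?w"
    by (subst summable_Suc_iff)
  have "(\<Sum>m\<in>F. (1 + \<bar>real_of_int m\<bar>) powr (- q)) \<le> 2 * suminf ?w" if "finite F" for F
  proof -
    let ?e = "\<lambda>m::int. (nat \<bar>m\<bar>, 0 \<le> m)"
    have inj: "inj_on ?e F"
      by (auto simp: inj_on_def split: if_splits)
    have "(\<Sum>m\<in>F. (1 + \<bar>real_of_int m\<bar>) powr (- q)) = (\<Sum>m\<in>F. ?w (fst (?e m)))"
      by (intro sum.cong) auto
    also have "\<dots> = (\<Sum>x\<in>?e ` F. ?w (fst x))"
      by (subst sum.reindex[OF inj]) simp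
    also have "\<dots> \<le> (\<Sum>x\<in>(\<lambda>m. nat \<bar>m\<bar>) ` F \<times> (UNIV :: bool set). ?w (fst x))"
      using that by (intro sum_mono2) auto
    also have "\<dots> = 2 * (\<Sum>k\<in>(\<lambda>m. nat \<bar>m\<bar>) ` F. ?w k)"
      by (simp add: sum.cartesian_product' UNIV_bool sum_distrib_left)
    also have "\<dots> \<le> 2 * suminf ?w"
      using that sm by (intro mult_left_mono sum_le_suminf) auto
    finally show ?thesis .
  qed
  then show thesis using that by blast
qed

lemma lattice_norm_minus_commute: "lattice_norm (i - j) = lattice_norm (j - i)"
proof -
  have "(\<chi> k. real_of_int ((i - j) $ k)) = - (\<chi> k. real_of_int ((j - i) $ k))"
    by (simp add: vec_eq_iff)
  then show ?thesis
    unfolding lattice_norm_def by (metis norm_minus_cancel)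
qed

lemma abs_component_le_lattice_norm: "\<bar>real_of_int (i $ k)\<bar> \<le> lattice_norm i"
  using component_le_norm_cart[of "\<chi> k. real_of_int (i $ k)" k] by (simp add: lattice_norm_def)

lemma one_le_lattice_norm:
  assumes "i \<noteq> 0"
  shows "1 \<le> lattice_norm i"
proof -
  obtain k where "i $ k \<noteq> 0"
    using assms by (auto simp: vec_eq_iff)
  then have "1 \<le> \<bar>real_of_int (i $ k)\<bar>" by linarith
  then show ?thesis
    using abs_component_le_lattice_norm[of i k] by linarith
qed

lemma finite_lattice_ball: "finite {i :: int ^ 'n::finite. lattice_norm i \<le> real N}"
proof (rule finite_subset)
  show "{i :: int ^ 'n. lattice_norm i \<le> real N} \<subseteq> vec_lambda ` (PiE UNIV (\<lambda>_. {- int N..int N}))"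
  proof
    fix i :: "int ^ 'n"
    assume "i \<in> {i. lattice_norm i \<le> real N}"
    then have "\<bar>real_of_int (i $ k)\<bar> \<le> real N" for k
      using abs_component_le_lattice_norm[of i k] by simp
    then have "\<bar>i $ k\<bar> \<le> int N" for k
      by (metis of_int_abs of_int_le_iff of_int_of_nat_eq)
    then have "vec_nth i \<in> PiE UNIV (\<lambda>_. {- int N..int N})"
      by (auto simp: PiE_iff abs_le_iff minus_le_iff)
    then show "i \<in> vec_lambda ` (PiE UNIV (\<lambda>_. {- int N..int N}))"
      by (metis image_eqI vec_nth_inverse)
  qed
qed (intro finite_imageI finite_PiE; simp)

text \<open>
  Since \<open>2 * lattice_norm i \<ge> 1 + \<bar>i $ k\<bar>\<close> for \<open>i \<noteq> 0\<close> and every \<open>k\<close>, the summand is dominated by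
  a product of one-dimensional weights with exponent \<open>p / n > 1\<close>.
\<close>

lemma sum_lattice_norm_powr_bounded:
  fixes p :: real
  assumes "p > real CARD('n::finite)"
  obtains K where "\<And>F :: (int ^ 'n) set. finite F \<Longrightarrow> 0 \<notin> F \<Longrightarrow>
    (\<Sum>i\<in>F. lattice_norm i powr (- p)) \<le> K"
proof -
  define q where "q = p / real CARD('n)"
  have q: "q > 1" "q * real CARD('n) = p"
    using assms by (simp_all add: q_def field_simps)
  define w where "w m = (1 + \<bar>real_of_int m\<bar>) powr (- q)" for m
  obtain K where K: "\<And>G. finite G \<Longrightarrow> sum w G \<le> K"
    using sum_int_powr_bounded[OF q(1)] unfolding w_def by blast
  have w0: "0 \<le> w m" for m by (simp add: w_def)
  have "(\<Sum>i\<in>F. lattice_norm i powr (- p)) \<le> 2 powr p * K ^ CARD('n)"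
    if F: "finite F" "0 \<notin> F" for F :: "(int ^ 'n) set"
  proof -
    \<comment> \<open>\<open>G\<close> collects every coordinate value occurring in
      \<open>F\<close>, so \<open>F\<close> embeds in the box of all functions into
      \<open>G\<close>, and the sum of products over that box factors into one-dimensional
      sums.\<close>
    define G where "G = (\<Union>k. (\<lambda>i. i $ k) ` F)"
    have G: "finite G" using F by (simp add: G_def)
    have le: "lattice_norm i powr (- p) \<le> 2 powr p * (\<Prod>k\<in>UNIV. w (i $ k))" if "i \<in> F" for i
    proof -
      have L: "1 \<le> lattice_norm i"
        using one_le_lattice_norm that F by metis
      have wk: "(2 * lattice_norm i) powr (- q) \<le> w (i $ k)" for k
        unfolding w_def using L abs_component_le_lattice_norm[of i k] q
        by (intro powr_mono2') auto
      have "(2 * lattice_norm i) powr (- p) = (\<Prod>k\<in>(UNIV :: 'n set). (2 * lattice_norm i) powr (- q))"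
        using L q by (simp add: powr_realpow[symmetric] powr_powr)
      also have "\<dots> \<le> (\<Prod>k\<in>UNIV. w (i $ k))"
        using wk by (intro prod_mono) auto
      finally have "2 powr p * (2 * lattice_norm i) powr (- p) \<le> 2 powr p * (\<Prod>k\<in>UNIV. w (i $ k))"
        by (rule mult_left_mono) simp
      then show ?thesis
        using L by (simp add: powr_mult powr_minus field_simps)
    qed
    have inj: "inj_on vec_nth F"
      by (auto simp: inj_on_def vec_nth_inject)
    have "(\<Sum>i\<in>F. \<Prod>k\<in>UNIV. w (i $ k)) = (\<Sum>\<phi>\<in>vec_nth ` F. \<Prod>k\<in>UNIV. w (\<phi> k))"
      by (subst sum.reindex[OF inj]) simp
    also have "\<dots> \<le> (\<Sum>\<phi>\<in>PiE (UNIV :: 'n set) (\<lambda>_. G). \<Prod>k\<in>UNIV. w (\<phi> k))"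
      using G w0 by (intro sum_mono2 finite_PiE) (auto simp: G_def intro: prod_nonneg)
    also have "\<dots> = (\<Prod>k\<in>(UNIV :: 'n set). sum w G)"
      using G by (subst prod_sum_PiE) auto
    also have "\<dots> \<le> K ^ CARD('n)"
      using K[OF G] w0 by (simp add: power_mono sum_nonneg)
    finally have "2 powr p * (\<Sum>i\<in>F. \<Prod>k\<in>UNIV. w (i $ k)) \<le> 2 powr p * K ^ CARD('n)"
      by (rule mult_left_mono) simp
    moreover have "(\<Sum>i\<in>F. lattice_norm i powr (- p)) \<le> 2 powr p * (\<Sum>i\<in>F. \<Prod>k\<in>UNIV. w (i $ k))"
      unfolding sum_distrib_left using le by (rule sum_mono)
    ultimately show ?thesis by linarith
  qed
  then show thesis using that by blast
qed

section \<open>Young's inequality for bilinear sums\<close>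

text \<open>
  The left-hand side is a weighted geometric mean of \<open>X * Y\<close>, \<open>X * Z\<close> and \<open>Y * Z\<close> with weights
  \<open>1 - c\<close>, \<open>1 - b\<close> and \<open>1 - a\<close>. For normalized sequences this pointwise bound replaces the
  three-fold Hoelder inequality in the proof of Young's inequality.
\<close>

lemma powr_mult3_le:
  fixes a b c X Y Z :: real
  assumes "0 \<le> X" "0 \<le> Y" "0 \<le> Z"
    and "0 \<le> a" "a \<le> 1" "0 \<le> b" "b \<le> 1" "0 \<le> c" "c \<le> 1" "a + b + c = 2"
  shows "X powr a * Y powr b * Z powr c \<le> X * Y + X * Z + Y * Z"
proof (cases "X = 0 \<or> Y = 0 \<or> Z = 0")
  case True
  \<comment> \<open>\<open>0 powr x = 0\<close> for every \<open>x\<close>, including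
    \<open>x = 0\<close>, so the left-hand side vanishes while the right-hand side is
    nonnegative.\<close>
  with assms show ?thesis by auto
next
  case False
  with assms have pos: "0 < X" "0 < Y" "0 < Z" by auto
  define m where "m = X * Y + X * Z + Y * Z"
  have m: "0 < m" using pos by (simp add: m_def add_pos_pos)
  have le: "X * Y \<le> m" "X * Z \<le> m" "Y * Z \<le> m"
    using pos by (simp_all add: m_def)
  have "X powr a * Y powr b * Z powr c
      = (X powr (1 - c) * X powr (1 - b)) * (Y powr (1 - c) * Y powr (1 - a)) * (Z powr (1 - b) * Z powr (1 - a))"
  proof -
    have "a = (1 - c) + (1 - b)" "b = (1 - c) + (1 - a)" "c = (1 - b) + (1 - a)"
      using assms by linarith+
    then show ?thesis by (metis powr_add)
  qed
  also have "\<dots> = (X * Y) powr (1 - c) * (X * Z) powr (1 - b) * (Y * Z) powr (1 - a)"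
    using pos by (simp add: powr_mult)
  \<comment> \<open>Each pairwise product is at most \<open>m\<close>, and the three exponents are
    nonnegative with sum 1 because \<open>a + b + c = 2\<close>; what remains is \<open>m\<close>
    itself.\<close>
  also have "\<dots> \<le> m powr (1 - c) * m powr (1 - b) * m powr (1 - a)"
    using pos le assms by (intro mult_mono powr_mono2) auto
  also have "\<dots> = m powr ((1 - c) + (1 - b) + (1 - a))"
    by (simp only: powr_add)
  also have "(1 - c) + (1 - b) + (1 - a) = 1" using assms by linarith
  finally show ?thesis using m by (simp add: m_def)
qed

text \<open>Uniform bounds on row and column sums of the kernel take the place of a convolution
  structure. After a power of \<open>M\<close> is split off from \<open>f i\<close>,
  \<open>powr_mult3_le\<close> applies to each term; summation gives 1 from \<open>X i * Y j\<close>
  and at most \<open>K\<close> from each of the two products with \<open>Z i j\<close>.\<close>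

lemma sum_bilinear_le_max_powr:
  fixes f g :: "'a \<Rightarrow> real" and k :: "'a \<Rightarrow> 'a \<Rightarrow> real"
  assumes f: "\<And>i. 0 \<le> f i" "\<And>i. i \<in> B \<Longrightarrow> f i \<le> M" "(\<Sum>i\<in>B. f i powr r) = 1"
    and g: "\<And>i. 0 \<le> g i" "(\<Sum>i\<in>B. g i powr s) = 1"
    and k: "\<And>i j. 0 \<le> k i j" "\<And>i. i \<in> B \<Longrightarrow> (\<Sum>j\<in>B. k i j powr (1 / c)) \<le> K"
      "\<And>j. j \<in> B \<Longrightarrow> (\<Sum>i\<in>B. k i j powr (1 / c)) \<le> K"
    and exps: "0 < a" "a \<le> 1" "1 \<le> s" "0 < c" "c \<le> 1" "a + 1 / s + c = 2" "r * a \<le> 1"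
  shows "(\<Sum>i\<in>B. \<Sum>j\<in>B. f i * g j * k i j) \<le> M powr (1 - r * a) * (1 + 2 * K)"
proof -
  define X Y Z where "X i = f i powr r" and "Y i = g i powr s" and "Z i j = k i j powr (1 / c)" for i j
  have nn: "0 \<le> X i" "0 \<le> Y i" "0 \<le> Z i j" for i j
    by (simp_all add: X_def Y_def Z_def)
  have term_le: "f i * g j * k i j \<le> M powr (1 - r * a) * (X i * Y j + X i * Z i j + Y j * Z i j)"
    if "i \<in> B" for i j
  proof -
    \<comment> \<open>The exponents \<open>1 - r * a\<close> and \<open>r * a\<close> add up to 1.
      Only the first factor is then estimated by \<open>M\<close>, which is monotone because
      \<open>r * a \<le> 1\<close>.\<close>
    have "f i = f i powr (1 - r * a) * X i powr a"
    proof (cases "f i = 0")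
      case False
      then show ?thesis
        using f(1)[of i] by (simp add: X_def powr_powr powr_add[symmetric])
    qed simp
    also have "\<dots> \<le> M powr (1 - r * a) * X i powr a"
      using f that exps by (intro mult_right_mono powr_mono2) auto
    finally have fi: "f i \<le> M powr (1 - r * a) * X i powr a" .
    have gj: "g j = Y j powr (1 / s)" and kij: "k i j = Z i j powr c"
      using g(1)[of j] k(1)[of i j] exps by (simp_all add: Y_def Z_def powr_powr)
    have "f i * g j * k i j \<le> (M powr (1 - r * a) * X i powr a) * g j * k i j"
      using fi g(1)[of j] k(1)[of i j] by (intro mult_right_mono)
    also have "\<dots> = M powr (1 - r * a) * (X i powr a * Y j powr (1 / s) * Z i j powr c)"
      by (simp add: gj[symmetric] kij[symmetric])
    also have "\<dots> \<le> M powr (1 - r * a) * (X i * Y j + X i * Z i j + Y j * Z i j)"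
      using nn exps by (intro mult_left_mono powr_mult3_le) auto
    finally show ?thesis .
  qed
  have XZ: "(\<Sum>i\<in>B. \<Sum>j\<in>B. X i * Z i j) \<le> K"
  proof -
    have "(\<Sum>i\<in>B. \<Sum>j\<in>B. X i * Z i j) \<le> (\<Sum>i\<in>B. X i * K)"
      unfolding sum_distrib_left[symmetric] using nn k(2)
      by (intro sum_mono mult_left_mono) (auto simp: Z_def)
    also have "\<dots> = K"
      using f(3) by (simp add: sum_distrib_right[symmetric] X_def)
    finally show ?thesis .
  qed
  have YZ: "(\<Sum>i\<in>B. \<Sum>j\<in>B. Y j * Z i j) \<le> K"
  proof -
    have "(\<Sum>i\<in>B. \<Sum>j\<in>B. Y j * Z i j) = (\<Sum>j\<in>B. \<Sum>i\<in>B. Y j * Z i j)"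
      by (rule sum.swap)
    also have "\<dots> \<le> (\<Sum>j\<in>B. Y j * K)"
      unfolding sum_distrib_left[symmetric] using nn k(3)
      by (intro sum_mono mult_left_mono) (auto simp: Z_def)
    also have "\<dots> = K"
      using g(2) by (simp add: sum_distrib_right[symmetric] Y_def)
    finally show ?thesis .
  qed
  have XY: "(\<Sum>i\<in>B. \<Sum>j\<in>B. X i * Y j) = 1"
    using f(3) g(2) by (simp add: sum_product[symmetric] X_def Y_def)
  have "(\<Sum>i\<in>B. \<Sum>j\<in>B. f i * g j * k i j)
      \<le> (\<Sum>i\<in>B. \<Sum>j\<in>B. M powr (1 - r * a) * (X i * Y j + X i * Z i j + Y j * Z i j))"
    using term_le by (intro sum_mono)
  also have "\<dots> = M powr (1 - r * a) * ((\<Sum>i\<in>B. \<Sum>j\<in>B. X i * Y j)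
      + (\<Sum>i\<in>B. \<Sum>j\<in>B. X i * Z i j) + (\<Sum>i\<in>B. \<Sum>j\<in>B. Y j * Z i j))"
    by (simp only: sum_distrib_left[symmetric] sum.distrib)
  also have "\<dots> \<le> M powr (1 - r * a) * (1 + 2 * K)"
    using XY XZ YZ by (intro mult_left_mono) auto
  finally show ?thesis .
qed

section \<open>The kernel and finitely supported sequences\<close>

text \<open>The zero diagonal absorbs the restriction \<open>j \<noteq> i\<close>, so the form
  becomes a double sum over a full square; the negated exponent turns the division into a
  multiplication.\<close>

definition HLS_kernel :: "real \<Rightarrow> int ^ 'n \<Rightarrow> int ^ 'n \<Rightarrow> real" where
  "HLS_kernel \<alpha> i j = (if i = j then 0 else lattice_norm (i - j) powr (\<alpha> - real CARD('n)))"

lemma HLS_kernel_nonneg: "0 \<le> HLS_kernel \<alpha> i j"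
  by (simp add: HLS_kernel_def)

lemma HLS_kernel_commute: "HLS_kernel \<alpha> i j = HLS_kernel \<alpha> j i"
  by (simp add: HLS_kernel_def lattice_norm_minus_commute[of i j])

lemma HLS_kernel_le_1:
  fixes i j :: "int ^ 'n::finite"
  assumes "\<alpha> < real CARD('n)"
  shows "HLS_kernel \<alpha> i j \<le> 1"
proof (cases "i = j")
  case False
  then have "1 \<le> lattice_norm (i - j)" by (simp add: one_le_lattice_norm)
  then have "lattice_norm (i - j) powr (\<alpha> - real CARD('n)) \<le> lattice_norm (i - j) powr 0"
    using assms by (intro powr_mono) auto
  with False \<open>1 \<le> lattice_norm (i - j)\<close> show ?thesis by (simp add: HLS_kernel_def)
qed (simp add: HLS_kernel_def)

text \<open>The substitution \<open>x = i - j\<close> turns every row into a sum over nonzero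
  lattice points, so a single \<open>K\<close> serves all rows and all finite
  \<open>B\<close>.\<close>

lemma HLS_kernel_row_bounded:
  fixes \<alpha> t :: real
  assumes "(real CARD('n::finite) - \<alpha>) * t > real CARD('n)"
  obtains K where "0 \<le> K" "\<And>B (i :: int ^ 'n). finite B \<Longrightarrow> (\<Sum>j\<in>B. HLS_kernel \<alpha> i j powr t) \<le> K"
proof -
  let ?p = "(real CARD('n) - \<alpha>) * t"
  obtain K where K: "\<And>F :: (int ^ 'n) set. finite F \<Longrightarrow> 0 \<notin> F \<Longrightarrow>
      (\<Sum>i\<in>F. lattice_norm i powr (- ?p)) \<le> K"
    using sum_lattice_norm_powr_bounded[OF assms] by blast
  have "(\<Sum>j\<in>B. HLS_kernel \<alpha> i j powr t) \<le> K" if "finite B" for B and i :: "int ^ 'n"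
  proof -
    have "(\<Sum>j\<in>B. HLS_kernel \<alpha> i j powr t) = (\<Sum>j\<in>B - {i}. lattice_norm (i - j) powr (- ?p))"
      using that by (intro sum.mono_neutral_cong_right)
        (auto simp: HLS_kernel_def powr_powr left_diff_distrib)
    also have "\<dots> = (\<Sum>x\<in>(\<lambda>j. i - j) ` (B - {i}). lattice_norm x powr (- ?p))"
      by (subst sum.reindex) (auto simp: inj_on_def)
    also have "\<dots> \<le> K" using that by (intro K) auto
    finally show ?thesis .
  qed
  moreover have "0 \<le> K" using K[of "{}"] by simp
  ultimately show thesis using that by blast
qed

text \<open>All terms outside the ball vanish; with this reduction the estimates take place in
  finite sums, free of convergence questions.\<close>

lemma HLS_form_eq_sum:
  fixes f g :: "int ^ 'n::finite \<Rightarrow> real"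
  assumes f: "supported_in_ball N f" and g: "supported_in_ball N g"
  defines "B \<equiv> {i :: int ^ 'n. lattice_norm i \<le> real N}"
  shows "HLS_form \<alpha> f g = (\<Sum>i\<in>B. \<Sum>j\<in>B. f i * g j * HLS_kernel \<alpha> i j)"
proof -
  have B: "finite B" unfolding B_def by (rule finite_lattice_ball)
  have f0: "f i = 0" if "i \<notin> B" for i using f that by (auto simp: supported_in_ball_def B_def)
  have g0: "g i = 0" if "i \<notin> B" for i using g that by (auto simp: supported_in_ball_def B_def)
  have inner: "(\<Sum>\<^sub>\<infinity>j\<in>{j. j \<noteq> i}. f i * g j / lattice_norm (i - j) powr (real CARD('n) - \<alpha>))
      = (\<Sum>j\<in>B. f i * g j * HLS_kernel \<alpha> i j)" for i
  proof -
    have "f i * g j / lattice_norm (i - j) powr (real CARD('n) - \<alpha>) = f i * g j * HLS_kernel \<alpha> i j"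
      if "j \<noteq> i" for j
      using that by (simp add: HLS_kernel_def powr_diff)
    then have "(\<Sum>\<^sub>\<infinity>j\<in>{j. j \<noteq> i}. f i * g j / lattice_norm (i - j) powr (real CARD('n) - \<alpha>))
        = (\<Sum>\<^sub>\<infinity>j\<in>B. f i * g j * HLS_kernel \<alpha> i j)"
      by (intro infsum_cong_neutral) (auto simp: g0 HLS_kernel_def)
    then show ?thesis using B by simp
  qed
  have "HLS_form \<alpha> f g = (\<Sum>\<^sub>\<infinity>i\<in>UNIV. \<Sum>j\<in>B. f i * g j * HLS_kernel \<alpha> i j)"
    unfolding HLS_form_def inner ..
  also have "\<dots> = (\<Sum>\<^sub>\<infinity>i\<in>B. \<Sum>j\<in>B. f i * g j * HLS_kernel \<alpha> i j)"
    by (intro infsum_cong_neutral) (auto simp: f0)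
  also have "\<dots> = (\<Sum>i\<in>B. \<Sum>j\<in>B. f i * g j * HLS_kernel \<alpha> i j)"
    using B by simp
  finally show ?thesis .
qed

lemma l_norm_eq_sum:
  fixes f :: "int ^ 'n::finite \<Rightarrow> real"
  assumes "supported_in_ball N f"
  shows "l_norm r f = (\<Sum>i\<in>{i. lattice_norm i \<le> real N}. \<bar>f i\<bar> powr r) powr (1 / r)"
proof -
  have "(\<Sum>\<^sub>\<infinity>i\<in>UNIV. \<bar>f i\<bar> powr r) = (\<Sum>\<^sub>\<infinity>i\<in>{i. lattice_norm i \<le> real N}. \<bar>f i\<bar> powr r)"
    using assms by (intro infsum_cong_neutral) (auto simp: supported_in_ball_def)
  then show ?thesis
    by (simp add: l_norm_def finite_lattice_ball)
qed

lemma l_norm_nonneg: "0 \<le> l_norm r f"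
  by (simp add: l_norm_def)

lemma abs_le_l_norm:
  fixes f :: "int ^ 'n::finite \<Rightarrow> real"
  assumes f: "supported_in_ball N f" and r: "0 < r"
  shows "\<bar>f i\<bar> \<le> l_norm r f"
proof (cases "lattice_norm i \<le> real N")
  case True
  have "\<bar>f i\<bar> = (\<bar>f i\<bar> powr r) powr (1 / r)"
    using r by (simp add: powr_powr)
  also have "\<dots> \<le> (\<Sum>i\<in>{i. lattice_norm i \<le> real N}. \<bar>f i\<bar> powr r) powr (1 / r)"
    using True r by (intro powr_mono2 member_le_sum finite_lattice_ball) auto
  finally show ?thesis using l_norm_eq_sum[OF f] by metis
next
  case False
  then show ?thesis
    using f l_norm_nonneg[of r f] by (simp add: supported_in_ball_def)
qed

lemma sum_powr_eq_1_of_l_norm: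
  fixes f :: "int ^ 'n::finite \<Rightarrow> real"
  assumes f: "supported_in_ball N f" "\<And>i. 0 \<le> f i" and "0 < r" and "l_norm r f = 1"
  shows "(\<Sum>i\<in>{i. lattice_norm i \<le> real N}. f i powr r) = 1"
proof -
  let ?S = "\<Sum>i\<in>{i. lattice_norm i \<le> real N}. f i powr r"
  have "?S powr (1 / r) = 1"
    using l_norm_eq_sum[OF f(1), of r] assms by simp
  moreover have "(?S powr (1 / r)) powr r = ?S"
    using \<open>0 < r\<close> by (simp add: powr_powr sum_nonneg)
  ultimately show ?thesis by simp
qed

lemma l_norm_indicator: "l_norm r (\<lambda>i. if i = x then 1 else 0) = 1"
proof -
  have "(\<Sum>\<^sub>\<infinity>i\<in>UNIV. \<bar>if i = x then 1 else (0::real)\<bar> powr r) = (\<Sum>\<^sub>\<infinity>i\<in>{x}. 1)"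
    by (intro infsum_cong_neutral) auto
  then show ?thesis by (simp add: l_norm_def)
qed

section \<open>Lower bound for the optimal constant\<close>

text \<open>
  \<open>HLS_const\<close> is a \<open>LEAST\<close> over the reals, so one first has to see that the minimum is attained:
  the admissible constants form a nonempty closed set that is bounded below.
\<close>

lemma one_le_HLS_const:
  fixes r s \<alpha> :: real
  assumes "0 < r" "0 < s" "\<alpha> < real CARD('n::finite)" "1 \<le> N"
  shows "1 \<le> HLS_const TYPE('n) r s \<alpha> N"
proof -
  define P where "P C \<longleftrightarrow> (\<forall>f g :: int ^ 'n \<Rightarrow> real.
      supported_in_ball N f \<longrightarrow> supported_in_ball N g \<longrightarrow>
      HLS_form \<alpha> f g \<le> C * l_norm r f * l_norm s g)" for C
  define B where "B = {i :: int ^ 'n. lattice_norm i \<le> real N}"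
  have B: "finite B" unfolding B_def by (rule finite_lattice_ball)
  have lower: "1 \<le> C" if "P C" for C
  proof -
    \<comment> \<open>The test pair consists of unit masses at 0 and at a unit vector
      \<open>e\<close>, where the kernel is 1; \<open>1 \<le> N\<close> puts both points in the
      ball.\<close>
    obtain k :: 'n where True by simp
    define e :: "int ^ 'n" where "e = axis k 1"
    define f g :: "int ^ 'n \<Rightarrow> real" where "f = (\<lambda>i. if i = 0 then 1 else 0)"
      and "g = (\<lambda>i. if i = e then 1 else 0)"
    have n0: "lattice_norm (0 :: int ^ 'n) = 0"
      by (simp add: lattice_norm_def vec_eq_iff norm_eq_zero)
    have "(\<chi> l. real_of_int (e $ l)) = axis k 1"
      by (simp add: vec_eq_iff e_def axis_def)
    then have ne: "lattice_norm e = 1"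
      by (simp add: lattice_norm_def norm_axis_1)
    have e0: "e \<noteq> 0" using ne n0 by auto
    have ker: "HLS_kernel \<alpha> 0 e = 1"
      using lattice_norm_minus_commute[of 0 e] e0 ne by (simp add: HLS_kernel_def)
    have mem: "0 \<in> B" "e \<in> B" using n0 ne assms by (auto simp: B_def)
    have supp: "supported_in_ball N f" "supported_in_ball N g"
      using n0 ne assms by (auto simp: supported_in_ball_def f_def g_def)
    have "(\<Sum>i\<in>B. \<Sum>j\<in>B. f i * g j * HLS_kernel \<alpha> i j)
        = (\<Sum>i\<in>B. if i = 0 then (\<Sum>j\<in>B. if j = e then HLS_kernel \<alpha> i j else 0) else 0)"
      by (intro sum.cong) (auto simp: f_def g_def intro!: sum.cong)
    also have "\<dots> = 1" using B mem ker by (simp add: sum.delta)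
    finally have "HLS_form \<alpha> f g = 1"
      using HLS_form_eq_sum[OF supp] unfolding B_def by metis
    moreover have "HLS_form \<alpha> f g \<le> C * l_norm r f * l_norm s g"
      using that supp unfolding P_def by blast
    ultimately show ?thesis
      by (simp add: f_def g_def l_norm_indicator)
  qed
  \<comment> \<open>A crude admissible constant, to make the admissible set nonempty: the kernel is
    at most 1 and each entry is at most the norm of its sequence.\<close>
  have "P (real (card B) * real (card B))"
    unfolding P_def
  proof (intro allI impI)
    fix f g :: "int ^ 'n \<Rightarrow> real"
    assume f: "supported_in_ball N f" and g: "supported_in_ball N g"
    have "HLS_form \<alpha> f g = (\<Sum>i\<in>B. \<Sum>j\<in>B. f i * g j * HLS_kernel \<alpha> i j)"
      using HLS_form_eq_sum[OF f g] unfolding B_def .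
    also have "\<dots> \<le> (\<Sum>i\<in>B. \<Sum>j\<in>B. l_norm r f * l_norm s g)"
    proof (intro sum_mono)
      fix i j
      have "f i * g j * HLS_kernel \<alpha> i j \<le> \<bar>f i * g j\<bar> * HLS_kernel \<alpha> i j"
        by (intro mult_right_mono HLS_kernel_nonneg) simp
      also have "\<dots> \<le> \<bar>f i * g j\<bar> * 1"
        using assms by (intro mult_left_mono HLS_kernel_le_1) auto
      also have "\<dots> \<le> l_norm r f * l_norm s g"
        unfolding abs_mult mult_1_right using f g assms
        by (intro mult_mono abs_le_l_norm l_norm_nonneg) auto
      finally show "f i * g j * HLS_kernel \<alpha> i j \<le> l_norm r f * l_norm s g" .
    qed
    finally show "HLS_form \<alpha> f g \<le> real (card B) * real (card B) * l_norm r f * l_norm s g"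
      by (simp add: mult.assoc)
  qed
  then have ne: "Collect P \<noteq> {}" by blast
  have bdd: "bdd_below (Collect P)" using lower by (auto simp: bdd_below_def)
  define m where "m = Inf (Collect P)"
  have "P m"
    unfolding P_def
  proof (intro allI impI)
    fix f g :: "int ^ 'n \<Rightarrow> real"
    assume f: "supported_in_ball N f" and g: "supported_in_ball N g"
    let ?ab = "l_norm r f * l_norm s g"
    have le: "HLS_form \<alpha> f g \<le> C * ?ab" if "P C" for C
      using that f g unfolding P_def by (simp add: mult.assoc)
    have "0 \<le> ?ab" by (simp add: l_norm_nonneg)
    \<comment> \<open>If the product of the norms is 0, any admissible constant gives the bound.
      Otherwise the form divided by this product is a lower bound for all admissible constants,
      hence for their infimum.\<close>
    then consider "?ab = 0" | "0 < ?ab" by linarith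
    then have "HLS_form \<alpha> f g \<le> m * ?ab"
    proof cases
      case 1
      then show ?thesis using ne le by auto
    next
      case 2
      then have "HLS_form \<alpha> f g / ?ab \<le> m"
        unfolding m_def using ne le by (intro cInf_greatest) (auto simp: pos_divide_le_eq)
      with 2 show ?thesis by (simp add: pos_divide_le_eq)
    qed
    then show "HLS_form \<alpha> f g \<le> m * l_norm r f * l_norm s g"
      by (simp add: mult.assoc)
  qed
  moreover have "m \<le> C" if "P C" for C
    unfolding m_def using that bdd by (intro cInf_lower) auto
  \<comment> \<open>The infimum is itself admissible, so it is the least element that
    \<open>LEAST\<close> picks.\<close>
  ultimately have "P (LEAST C. P C)"
    by (rule LeastI2_order) simp_all
  then show ?thesis
    using lower unfolding HLS_const_def P_def by blast
qed

section \<open>Lower bound for the maximum\<close>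

text \<open>Maximality enters only through the value of the form being at least 1. The constant is
  chosen before \<open>B\<close>, which makes it independent of \<open>N\<close> later.\<close>

lemma bilinear_max_lower_bound:
  fixes r s \<alpha> :: real
  assumes r: "r > 1" and s: "s > 1" and \<alpha>: "0 < \<alpha>" "\<alpha> < real CARD('n::finite)"
    and gap: "1 / r + 1 / s + (real CARD('n) - \<alpha>) / real CARD('n) > 2"
  obtains c where "c > 0"
    "\<And>B (f :: int ^ 'n \<Rightarrow> real) g. finite B \<Longrightarrow> (\<And>i. 0 \<le> f i) \<Longrightarrow> (\<And>i. 0 \<le> g i) \<Longrightarrow>
      (\<Sum>i\<in>B. f i powr r) = 1 \<Longrightarrow> (\<Sum>i\<in>B. g i powr s) = 1 \<Longrightarrow>
      1 \<le> (\<Sum>i\<in>B. \<Sum>j\<in>B. f i * g j * HLS_kernel \<alpha> i j) \<Longrightarrow> c \<le> Max (f ` B)"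
proof -
  let ?n = "real CARD('n)"
  \<comment> \<open>The gap hypothesis leaves room for \<open>a\<close> here. Its upper bound makes
    \<open>1 - r * a\<close> positive; its lower bound gives \<open>c < (n - \<alpha>) / n\<close>,
    so that the power \<open>1 / c\<close> of the kernel has bounded row sums.\<close>
  have "max 0 (2 - 1 / s - (?n - \<alpha>) / ?n) < 1 / r"
    using r gap by simp
  then obtain a where a: "max 0 (2 - 1 / s - (?n - \<alpha>) / ?n) < a" "a < 1 / r"
    using dense by blast
  define c where "c = 2 - a - 1 / s"
  have inv: "1 / r < 1" "1 / s < 1" using r s by simp_all
  have c: "0 < c" "c < (?n - \<alpha>) / ?n"
    using a inv by (simp_all add: c_def)
  have "(?n - \<alpha>) / ?n < 1" using \<alpha> by simp
  with c have c1: "c < 1" by linarith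
  have ra: "r * a < 1" using a(2) r by (simp add: field_simps)
  have "(?n - \<alpha>) * (1 / c) > ?n"
    using c by (simp add: field_simps)
  then obtain K where K: "0 \<le> K" "\<And>B (i :: int ^ 'n). finite B \<Longrightarrow> (\<Sum>j\<in>B. HLS_kernel \<alpha> i j powr (1 / c)) \<le> K"
    using HLS_kernel_row_bounded by blast
  define \<theta> where "\<theta> = 1 - r * a"
  have \<theta>: "0 < \<theta>" using ra by (simp add: \<theta>_def)
  \<comment> \<open>\<open>d\<close> solves \<open>d powr \<theta> * (1 + 2 * K) = 1\<close>, so a
    maximum below \<open>d\<close> would force the form below 1.\<close>
  define d where "d = (1 / (1 + 2 * K)) powr (1 / \<theta>)"
  have d: "0 < d" "d powr \<theta> = 1 / (1 + 2 * K)"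
    using K \<theta> by (simp_all add: d_def powr_powr)
  have "d \<le> Max (f ` B)"
    if B: "finite B" and f: "\<And>i. 0 \<le> f i" "(\<Sum>i\<in>B. f i powr r) = 1"
      and g: "\<And>i. 0 \<le> g i" "(\<Sum>i\<in>B. g i powr s) = 1"
      and one: "1 \<le> (\<Sum>i\<in>B. \<Sum>j\<in>B. f i * g j * HLS_kernel \<alpha> i j)"
    for B and f g :: "int ^ 'n \<Rightarrow> real"
  proof (rule ccontr)
    let ?M = "Max (f ` B)"
    assume "\<not> d \<le> ?M"
    have "B \<noteq> {}" using f(2) by auto
    then obtain x where "x \<in> B" by blast
    have le: "f i \<le> ?M" if "i \<in> B" for i using B that by simp
    have M: "0 \<le> ?M" using f(1)[of x] le[OF \<open>x \<in> B\<close>] by linarith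
    have "1 \<le> ?M powr (1 - r * a) * (1 + 2 * K)"
    proof (rule order_trans[OF one sum_bilinear_le_max_powr])
      \<comment> \<open>Column sums are row sums, since the kernel is symmetric.\<close>
      show "(\<Sum>i\<in>B. HLS_kernel \<alpha> i j powr (1 / c)) \<le> K" for j
        using K(2)[OF B, of j] by (simp add: HLS_kernel_commute[of _ _ j])
    qed (use f g le K(2)[OF B] a c c1 s inv ra in \<open>simp_all add: HLS_kernel_nonneg\<close>, simp_all add: c_def)
    moreover have "?M powr \<theta> < d powr \<theta>"
      using M \<theta> \<open>\<not> d \<le> ?M\<close> by (intro powr_less_mono2) auto
    then have "?M powr \<theta> * (1 + 2 * K) < 1"
      using K(1) d(2) by (simp add: pos_less_divide_eq)
    ultimately show False
      by (simp add: \<theta>_def)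
  qed
  then show thesis using that d(1) by blast
qed

theorem theorem1p2:
  fixes r s \<alpha> :: real
  assumes "r > 1" and "s > 1"
    and "0 < \<alpha>" and "\<alpha> < real CARD('n::finite)"
    and "1 / r + 1 / s + (real CARD('n) - \<alpha>) / real CARD('n) > 2"
  shows "\<exists>c > 0. \<forall>N \<ge> 1. \<forall>f g :: int ^ 'n \<Rightarrow> real. maximizing_pair r s \<alpha> N f g \<longrightarrow>
           c \<le> Max (f ` {i. lattice_norm i \<le> real N}) \<and>
           c \<le> Max (g ` {i. lattice_norm i \<le> real N})"
proof -
  obtain c where c: "c > 0"
    "\<And>B (f :: int ^ 'n \<Rightarrow> real) g. finite B \<Longrightarrow> (\<And>i. 0 \<le> f i) \<Longrightarrow> (\<And>i. 0 \<le> g i) \<Longrightarrow>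
      (\<Sum>i\<in>B. f i powr r) = 1 \<Longrightarrow> (\<Sum>i\<in>B. g i powr s) = 1 \<Longrightarrow>
      1 \<le> (\<Sum>i\<in>B. \<Sum>j\<in>B. f i * g j * HLS_kernel \<alpha> i j) \<Longrightarrow> c \<le> Max (f ` B)"
    using bilinear_max_lower_bound[OF assms] by blast
  have gap': "1 / s + 1 / r + (real CARD('n) - \<alpha>) / real CARD('n) > 2"
    using assms(5) by linarith
  \<comment> \<open>The same bound with \<open>r\<close> and \<open>s\<close> exchanged, to be
    applied with \<open>g\<close> as the first sequence.\<close>
  obtain c' where c': "c' > 0"
    "\<And>B (f :: int ^ 'n \<Rightarrow> real) g. finite B \<Longrightarrow> (\<And>i. 0 \<le> f i) \<Longrightarrow> (\<And>i. 0 \<le> g i) \<Longrightarrow>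
      (\<Sum>i\<in>B. f i powr s) = 1 \<Longrightarrow> (\<Sum>i\<in>B. g i powr r) = 1 \<Longrightarrow>
      1 \<le> (\<Sum>i\<in>B. \<Sum>j\<in>B. f i * g j * HLS_kernel \<alpha> i j) \<Longrightarrow> c' \<le> Max (f ` B)"
    using bilinear_max_lower_bound[OF assms(2,1,3,4) gap'] by blast
  show ?thesis
  proof (intro exI[of _ "min c c'"] conjI allI impI)
    show "0 < min c c'" using c c' by simp
    fix N :: nat and f g :: "int ^ 'n \<Rightarrow> real"
    assume N: "1 \<le> N" and mp: "maximizing_pair r s \<alpha> N f g"
    define B where "B = {i :: int ^ 'n. lattice_norm i \<le> real N}"
    have B: "finite B" unfolding B_def by (rule finite_lattice_ball)
    have nn: "\<And>i. 0 \<le> f i" "\<And>i. 0 \<le> g i"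
      and supp: "supported_in_ball N f" "supported_in_ball N g"
      and norm: "l_norm r f = 1" "l_norm s g = 1"
      and J: "HLS_form \<alpha> f g = HLS_const TYPE('n) r s \<alpha> N"
      using mp by (auto simp: maximizing_pair_def)
    have sums: "(\<Sum>i\<in>B. f i powr r) = 1" "(\<Sum>i\<in>B. g i powr s) = 1"
      using nn supp norm assms unfolding B_def by (auto intro!: sum_powr_eq_1_of_l_norm)
    have one: "1 \<le> (\<Sum>i\<in>B. \<Sum>j\<in>B. f i * g j * HLS_kernel \<alpha> i j)"
      using one_le_HLS_const[of r s \<alpha> N, where 'n='n] assms N J HLS_form_eq_sum[OF supp]
      unfolding B_def by simp
    \<comment> \<open>Swapping the summations and using symmetry of the kernel shows that the form
      keeps its value when \<open>f\<close> and \<open>g\<close> trade places.\<close>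
    then have one': "1 \<le> (\<Sum>i\<in>B. \<Sum>j\<in>B. g i * f j * HLS_kernel \<alpha> i j)"
      by (subst sum.swap) (simp add: HLS_kernel_commute mult.commute)
    show "min c c' \<le> Max (f ` {i. lattice_norm i \<le> real N})"
      using c(2)[OF B nn sums one] unfolding B_def by linarith
    show "min c c' \<le> Max (g ` {i. lattice_norm i \<le> real N})"
      using c'(2)[OF B nn(2,1) sums(2,1) one'] unfolding B_def by linarith
  qed
qed

end
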